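(* For every integer $k\ge 4$, $S_{2,2,1}\le C_k$.
   Context: All graphs are finite and simple, considered up to isomorphism. An edge-colored graph is a pair $(G,c)$ with $c\colon E(G)\to\mathbb{N}$ an arbitrary map (not necessarily proper); it is colored in $t$ or more colors if $|c(E(G))|\ge t$. A subgraph (not necessarily induced) is rainbow if its edges receive pairwise distinct colors. $(G,c)$ is rainbow $H$-free if $G$ contains no rainbow subgraph isomorphic to $H$. For graphs $H_1,H_2$, write $H_1\le H_2$ if there is a positive integer $t$ such that every rainbow $H_1$-free edge-colored complete graph colored in $t$ or more colors is rainbow $H_2$-free. $C_k$ is the cycle on $k$ vertices. For positive integers $a,b,c$, $S_{a,b,c}$ is the tree consisting of one vertex (the branch vertex) joined by three internally disjoint paths of lengths $a$, $b$, $c$ (legs); it has $a+b+c+1$ vertices. *)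

theory Defs
  imports Main
begin

record 'a graph =
  verts :: "'a set"
  edges :: "'a set set"

definition simple_graph :: "'a graph \<Rightarrow> bool" where
  "simple_graph G \<longleftrightarrow>
     finite (verts G) \<and> edges G \<subseteq> {e. e \<subseteq> verts G \<and> card e = 2}"

definition complete_graph :: "'a graph \<Rightarrow> bool" where
  "complete_graph G \<longleftrightarrow>
     simple_graph G \<and> edges G = {e. e \<subseteq> verts G \<and> card e = 2}"

definition subgraph_of :: "'a graph \<Rightarrow> 'a graph \<Rightarrow> bool" where
  "subgraph_of F G \<longleftrightarrow>
     simple_graph F \<and> verts F \<subseteq> verts G \<and> edges F \<subseteq> edges G"

definition graph_isomorphic :: "'a graph \<Rightarrow> 'b graph \<Rightarrow> bool" where
  "graph_isomorphic G H \<longleftrightarrow>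
     (\<exists>f. bij_betw f (verts G) (verts H) \<and> edges H = (\<lambda>e. f ` e) ` edges G)"

text \<open>
  An edge-colouring of \<open>G\<close> is a function on vertex sets of which only the values on
  \<open>edges G\<close> are ever used.
\<close>

definition rainbow :: "('a set \<Rightarrow> nat) \<Rightarrow> 'a graph \<Rightarrow> bool" where
  "rainbow c F \<longleftrightarrow> inj_on c (edges F)"

definition rainbow_free :: "'b graph \<Rightarrow> 'a graph \<Rightarrow> ('a set \<Rightarrow> nat) \<Rightarrow> bool" where
  "rainbow_free H G c \<longleftrightarrow>
     \<not> (\<exists>F. subgraph_of F G \<and> graph_isomorphic F H \<and> rainbow c F)"

definition colored_in_at_least :: "nat \<Rightarrow> 'a graph \<Rightarrow> ('a set \<Rightarrow> nat) \<Rightarrow> bool" where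
  "colored_in_at_least t G c \<longleftrightarrow> t \<le> card (c ` edges G)"

text \<open>
  The complete graphs range over all finite vertex sets of natural numbers: every finite
  graph is isomorphic to one of these.
\<close>

definition rainbow_le :: "'a graph \<Rightarrow> 'b graph \<Rightarrow> bool" where
  "rainbow_le H1 H2 \<longleftrightarrow>
     (\<exists>t>0. \<forall>(K :: nat graph) c.
        complete_graph K \<longrightarrow> colored_in_at_least t K c \<longrightarrow>
        rainbow_free H1 K c \<longrightarrow> rainbow_free H2 K c)"

text \<open>The following is the cycle on \<open>k\<close> vertices only for \<open>k \<ge> 3\<close>.\<close>

definition cycle_graph :: "nat \<Rightarrow> nat graph" where
  "cycle_graph k =
     \<lparr> verts = {..<k}, edges = {{i, (i + 1) mod k} | i. i < k} \<rparr>"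

text \<open>
  Vertex at distance \<open>j\<close> from the branch vertex on leg \<open>i\<close> of a spider; the branch vertex
  \<open>(0, 0)\<close> is shared by all legs.
\<close>

definition leg_vertex :: "nat \<Rightarrow> nat \<Rightarrow> nat \<times> nat" where
  "leg_vertex i j = (if j = 0 then (0, 0) else (i, j))"

definition spider :: "nat \<Rightarrow> nat \<Rightarrow> nat \<Rightarrow> (nat \<times> nat) graph" where
  "spider a b c =
     \<lparr> verts = {leg_vertex i j | i j. i < 3 \<and> j \<le> [a, b, c] ! i},
       edges = {{leg_vertex i j, leg_vertex i (j + 1)} | i j. i < 3 \<and> j < [a, b, c] ! i} \<rparr>"

end

theory Submission
  imports Defs
begin

text \<open>
  A rainbow \<open>C\<^sub>k\<close> in a complete graph without rainbow \<open>S\<^sub>2\<^sub>,\<^sub>2\<^sub>,\<^sub>1\<close> bounds the number of colours.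

  For \<open>k \<ge> 5\<close>, every colour already occurs among the cycle vertices. An edge from a cycle vertex
  \<open>v\<^sub>i\<close> to the outside repeats one of the four cycle colours around \<open>v\<^sub>i\<close>, since otherwise it is the
  short leg of a rainbow spider at \<open>v\<^sub>i\<close>. Given an outside edge \<open>xy\<close> of a new colour, \<open>xv\<^sub>i\<close> must even have
  the colour of one of the two cycle edges at \<open>v\<^sub>i\<close>. Spiders centred at \<open>x\<close> with short leg \<open>xy\<close>
  then force \<open>xv\<^sub>i\<close> to have the colour of \<open>v\<^sub>i\<^sub>-\<^sub>1v\<^sub>i\<close> and \<open>xv\<^sub>i\<^sub>+\<^sub>2\<close> that of \<open>v\<^sub>i\<^sub>+\<^sub>2v\<^sub>i\<^sub>+\<^sub>3\<close>, for all
  \<open>i\<close>, which is contradictory at \<open>v\<^sub>i\<^sub>+\<^sub>2\<close>.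

  For \<open>k = 4\<close>, at most three further colours occur on the edges leaving each corner of the cycle.
  A colour that occurs on no edge meeting the cycle is called fresh. The ends of a fresh edge see the
  cycle exactly as some cycle vertex does, and with this information two fresh colours always yield
  a rainbow spider.
\<close>

section \<open>Modular indices and the spider condition\<close>

lemma add_mod_cancel:
  fixes a b i k :: nat
  assumes "a < k" "b < k"
  shows "(i + a) mod k = (i + b) mod k \<longleftrightarrow> a = b"
  using assms mod_eq_dvd_iff_nat[of "i + a" "i + b" k] mod_eq_dvd_iff_nat[of "i + b" "i + a" k]
  by (cases "a \<le> b") (auto dest: dvd_imp_le)

text \<open>\<open>v\<close> is the branch vertex, \<open>a, a'\<close> and \<open>b, b'\<close> are
  the long legs, \<open>p\<close> is the short one. The colour exclusions below are instances of
  this condition.\<close>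

locale spider_free =
  fixes V :: "'a set" and c :: "'a set \<Rightarrow> nat"
  assumes no_spider:
    "\<not> (distinct [v, a, a', b, b', p] \<and> {v, a, a', b, b', p} \<subseteq> V \<and>
      distinct [c {v, a}, c {a, a'}, c {v, b}, c {b, b'}, c {v, p}])"
begin

section \<open>Edges leaving a corner of a rainbow four-cycle\<close>

definition rainbow_C4 :: "'a \<Rightarrow> 'a \<Rightarrow> 'a \<Rightarrow> 'a \<Rightarrow> bool" where
  "rainbow_C4 p q r s \<longleftrightarrow> {p, q, r, s} \<subseteq> V \<and> distinct [p, q, r, s] \<and>
     distinct [c {p, q}, c {q, r}, c {r, s}, c {s, p}]"

lemma rainbow_C4_rotate: "rainbow_C4 p q r s \<Longrightarrow> rainbow_C4 q r s p"
  by (auto simp: rainbow_C4_def)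

lemma rainbow_C4_reflect: "rainbow_C4 p q r s \<Longrightarrow> rainbow_C4 p s r q"
  by (auto simp: rainbow_C4_def insert_commute)

text \<open>The colours at \<open>p\<close> need only avoid the four cycle colours, whereas
  \<open>fresh_color\<close> below concerns all edges meeting the cycle. Taking one leaf per colour
  turns counting colours into counting vertices.\<close>

definition fresh_star :: "'a \<Rightarrow> 'a \<Rightarrow> 'a \<Rightarrow> 'a \<Rightarrow> 'a set \<Rightarrow> bool" where
  "fresh_star p q r s X \<longleftrightarrow> rainbow_C4 p q r s \<and> inj_on (\<lambda>x. c {p, x}) X \<and>
     (\<forall>x\<in>X. x \<in> V - {p, q, r, s} \<and> c {p, x} \<notin> {c {p, q}, c {q, r}, c {r, s}, c {s, p}})"

lemma fresh_star_reflect: "fresh_star p q r s X \<Longrightarrow> fresh_star p s r q X"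
  by (auto simp: fresh_star_def rainbow_C4_reflect insert_commute)

lemma fresh_star_C4: "fresh_star p q r s X \<Longrightarrow> rainbow_C4 p q r s"
  by (simp add: fresh_star_def)

lemma fresh_star_leaf:
  assumes "fresh_star p q r s X" "x \<in> X"
  shows "x \<in> V" "distinct [p, q, r, s, x]"
    "distinct [c {p, q}, c {q, r}, c {r, s}, c {s, p}, c {p, x}]"
  using assms by (simp_all add: fresh_star_def rainbow_C4_def) metis+

lemma fresh_star_inj:
  "fresh_star p q r s X \<Longrightarrow> x \<in> X \<Longrightarrow> y \<in> X \<Longrightarrow> c {p, x} = c {p, y} \<Longrightarrow> x = y"
  by (auto simp: fresh_star_def dest: inj_onD)

text \<open>Spiders at \<open>p\<close> and at \<open>q\<close>, both using another leaf
  \<open>z\<close>, leave only the colours of \<open>pq\<close>, \<open>rs\<close> and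
  \<open>pz\<close>. Two choices of \<open>z\<close> rule out the last.\<close>

lemma fresh_star_side:
  assumes F: "fresh_star p q r s X" and X: "{x, x', y} \<subseteq> X" "distinct [x, x', y]"
  shows "c {q, y} = c {p, q} \<or> c {q, y} = c {r, s}"
proof -
  note facts = fresh_star_C4[OF F, unfolded rainbow_C4_def] fresh_star_leaf[OF F]
  have 1: "c {q, y} \<in> {c {p, q}, c {r, s}, c {s, p}, c {p, z}}" if "z \<in> X" "z \<noteq> y" for z
    using no_spider[of p q y s r z] facts(1) facts(2-)[of y] facts(2-)[of z] that X
    by (simp add: insert_commute) metis
  have 2: "c {q, y} \<in> {c {p, q}, c {q, r}, c {r, s}, c {p, z}}" if "z \<in> X" "z \<noteq> y" for z
    using no_spider[of q p z r s y] facts(1) facts(2-)[of y] facts(2-)[of z] that X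
    by (simp add: insert_commute) metis
  have "c {q, y} \<in> {c {p, q}, c {r, s}, c {p, z}}" if "z \<in> X" "z \<noteq> y" for z
    using 1[OF that] 2[OF that] facts(1) by auto
  from this[of x] this[of x'] show ?thesis
    using X fresh_star_inj[OF F, of x x'] by auto
qed

text \<open>Two spiders at \<open>p\<close> with long leg \<open>p, u, v\<close> leave only the
  colours of \<open>pq\<close>, \<open>sp\<close> and \<open>pu\<close>. Exchanging \<open>u\<close>
  and \<open>v\<close> rules out the last.\<close>

lemma fresh_star_leaves:
  assumes F: "fresh_star p q r s X" and X: "{x, y} \<subseteq> X" "x \<noteq> y"
  shows "c {x, y} = c {p, q} \<or> c {x, y} = c {s, p}"
proof -
  have *: "c {u, v} \<in> {c {p, q}, c {s, p}, c {p, u}}"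
    if "u \<in> X" "v \<in> X" "u \<noteq> v" for u v
    using no_spider[of p u v q r s] no_spider[of p u v s r q] that
      fresh_star_C4[OF F] fresh_star_leaf[OF F, of u] fresh_star_leaf[OF F, of v]
    by (auto simp: insert_commute eq_commute[where 'a = nat] rainbow_C4_def)
  from *[of x y] *[of y x] show ?thesis
    using X fresh_star_inj[OF F, of x y] by (auto simp: insert_commute)
qed

text \<open>With the colour of \<open>pq\<close> on \<open>yz\<close>, the legs
  \<open>y, s, r\<close> and \<open>y, p, x\<close> and the short leg \<open>yz\<close> would form a
  rainbow spider.\<close>

lemma fresh_star_propagate:
  assumes F: "fresh_star p q r s X" and X: "{x, y, z} \<subseteq> X" "distinct [x, y, z]"
    and sy: "c {s, y} = c {s, p}"
  shows "c {y, z} = c {s, p}"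
proof -
  have "c {y, z} \<noteq> c {p, q}"
    using no_spider[of y s r p x z] sy X fresh_star_C4[OF F] fresh_star_inj[OF F, of x y]
      fresh_star_leaf[OF F, of x] fresh_star_leaf[OF F, of y] fresh_star_leaf[OF F, of z]
    by (auto simp: insert_commute eq_commute[where 'a = nat] rainbow_C4_def)
  with fresh_star_leaves[OF F, of y z] X show ?thesis by auto
qed

text \<open>The other colour allowed by \<open>fresh_star_side\<close>, that of \<open>rs\<close>,
  completes a rainbow spider at \<open>p\<close> with legs \<open>p, q, z\<close> and
  \<open>p, s, y\<close> and short leg \<open>px\<close>.\<close>

lemma fresh_star_opposite:
  assumes F: "fresh_star p q r s X" and X: "{x, y, z} \<subseteq> X" "distinct [x, y, z]"
    and sy: "c {s, y} = c {q, r}"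
  shows "c {q, z} = c {p, q}"
  using no_spider[of p q z s y x] fresh_star_side[OF F, of x y z] sy X fresh_star_C4[OF F]
    fresh_star_leaf[OF F, of x] fresh_star_leaf[OF F, of y] fresh_star_leaf[OF F, of z]
  by (auto simp: insert_commute eq_commute[where 'a = nat] rainbow_C4_def)

text \<open>The two preceding facts force the colour of \<open>pq\<close> on \<open>zy\<close>. Then
  the legs \<open>s, y, z\<close> and \<open>s, p, x\<close> and the short leg \<open>sr\<close> are
  rainbow.\<close>

lemma fresh_star_not_opposite:
  assumes F: "fresh_star p q r s X" and X: "{x, y, z, w} \<subseteq> X" "distinct [x, y, z, w]"
    and sy: "c {s, y} = c {q, r}"
  shows False
proof -
  have "c {q, z} = c {p, q}"
    using fresh_star_opposite[OF F, of x y z] assms by auto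
  then have "c {z, y} = c {p, q}"
    using fresh_star_propagate[OF fresh_star_reflect[OF F], of x z y] X by (auto simp: insert_commute)
  then show False
    using no_spider[of s y z p x r] sy X fresh_star_C4[OF F]
      fresh_star_leaf[OF F, of x] fresh_star_leaf[OF F, of y] fresh_star_leaf[OF F, of z]
    by (auto simp: insert_commute eq_commute[where 'a = nat] rainbow_C4_def)
qed

text \<open>Propagation from \<open>s\<close> and from \<open>q\<close> gives \<open>yz\<close> two
  different colours.\<close>

lemma no_fresh_star:
  assumes F: "fresh_star p q r s X" and X: "{x, y, z, w} \<subseteq> X" "distinct [x, y, z, w]"
  shows False
proof -
  note F' = fresh_star_reflect[OF F]
  have "c {s, y} = c {s, p}"
    using fresh_star_side[OF F', of x z y] fresh_star_not_opposite[OF F X] X by (auto simp: insert_commute)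
  then have "c {y, z} = c {s, p}"
    using fresh_star_propagate[OF F, of x y z] X by auto
  moreover have "c {q, y} = c {p, q}"
    using fresh_star_side[OF F, of x z y] fresh_star_not_opposite[OF F' X] X by (auto simp: insert_commute)
  then have "c {y, z} = c {p, q}"
    using fresh_star_propagate[OF F', of x y z] X by (auto simp: insert_commute)
  ultimately show False using F by (auto simp: fresh_star_def rainbow_C4_def)
qed

section \<open>Colours on no edge meeting the four-cycle\<close>

definition fresh_color :: "'a \<Rightarrow> 'a \<Rightarrow> 'a \<Rightarrow> 'a \<Rightarrow> nat \<Rightarrow> bool" where
  "fresh_color p q r s n \<longleftrightarrow> (\<forall>u\<in>{p, q, r, s}. \<forall>x\<in>V. x \<noteq> u \<longrightarrow> c {u, x} \<noteq> n)"

lemma fresh_color_rotate: "fresh_color p q r s n \<Longrightarrow> fresh_color q r s p n"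
  by (auto simp: fresh_color_def)

lemma fresh_color_reflect: "fresh_color p q r s n \<Longrightarrow> fresh_color p s r q n"
  by (auto simp: fresh_color_def)

definition fresh_edge :: "'a \<Rightarrow> 'a \<Rightarrow> 'a \<Rightarrow> 'a \<Rightarrow> 'a \<Rightarrow> 'a \<Rightarrow> bool" where
  "fresh_edge p q r s x y \<longleftrightarrow> {x, y} \<subseteq> V \<and> x \<noteq> y \<and> rainbow_C4 p q r s \<and>
     fresh_color p q r s (c {x, y})"

lemma fresh_edge_rotate: "fresh_edge p q r s x y \<Longrightarrow> fresh_edge q r s p x y"
  by (simp add: fresh_edge_def fresh_color_rotate rainbow_C4_rotate)

lemma fresh_edge_reflect: "fresh_edge p q r s x y \<Longrightarrow> fresh_edge p s r q x y"
  by (simp add: fresh_edge_def fresh_color_reflect rainbow_C4_reflect)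

lemma fresh_edge_commute: "fresh_edge p q r s x y \<Longrightarrow> fresh_edge p q r s y x"
  by (auto simp add: fresh_edge_def insert_commute)

lemma fresh_edge_vertices:
  assumes "fresh_edge p q r s x y"
  shows "{p, q, r, s, x, y} \<subseteq> V" "distinct [p, q, r, s, x, y]"
    "distinct [c {p, q}, c {q, r}, c {r, s}, c {s, p}, c {x, y}]"
  using assms unfolding fresh_edge_def fresh_color_def rainbow_C4_def
  by (auto simp: insert_commute)

lemma fresh_edge_color:
  assumes "fresh_edge p q r s x y" "z \<in> V" "z \<notin> {p, q, r, s}"
  shows "c {x, y} \<notin> {c {p, z}, c {q, z}, c {r, z}, c {s, z}}"
  using assms unfolding fresh_edge_def fresh_color_def by (auto simp: insert_commute)

lemma fresh_edge_end:
  assumes F: "fresh_edge p q r s x y"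
  shows "c {x, y} \<notin> {c {p, x}, c {q, x}, c {r, x}, c {s, x}}"
    "c {x, y} \<notin> {c {p, y}, c {q, y}, c {r, y}, c {s, y}}"
proof -
  have "x \<in> V" "x \<notin> {p, q, r, s}" "y \<in> V" "y \<notin> {p, q, r, s}"
    using fresh_edge_vertices(1,2)[OF F] by auto
  then show "c {x, y} \<notin> {c {p, x}, c {q, x}, c {r, x}, c {s, x}}"
    "c {x, y} \<notin> {c {p, y}, c {q, y}, c {r, y}, c {s, y}}"
    using fresh_edge_color[OF F] by blast+
qed

text \<open>In the two spiders at \<open>p\<close> with long leg \<open>p, x, y\<close> only
  \<open>px\<close> can repeat a colour; the cycle colours common to both spiders are those of
  \<open>pq\<close> and \<open>sp\<close>.\<close>

lemma fresh_edge_corner: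
  assumes F: "fresh_edge p q r s x y"
  shows "c {p, x} = c {p, q} \<or> c {p, x} = c {s, p}"
proof (rule ccontr)
  assume "\<not> (c {p, x} = c {p, q} \<or> c {p, x} = c {s, p})"
  then show False
    using no_spider[of p x y q r s] no_spider[of p x y s r q]
      fresh_edge_vertices[OF F] fresh_edge_end[OF F]
    by (clarsimp simp: insert_commute)
qed

text \<open>In the mixed cases the legs from \<open>x\<close> through \<open>p\<close> and
  \<open>r\<close> extend to different vertices among \<open>q\<close> and \<open>s\<close>, and
  with short leg \<open>xy\<close> they form a rainbow spider.\<close>

lemma fresh_edge_corners:
  assumes F: "fresh_edge p q r s x y"
  shows "c {p, x} = c {p, q} \<and> c {r, x} = c {q, r} \<or> c {p, x} = c {s, p} \<and> c {r, x} = c {r, s}"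
proof -
  have "c {p, x} = c {p, q} \<or> c {p, x} = c {s, p}" "c {r, x} = c {r, s} \<or> c {r, x} = c {q, r}"
    using fresh_edge_corner[OF F] fresh_edge_corner[OF fresh_edge_rotate[OF fresh_edge_rotate[OF F]]] by auto
  moreover have "c {p, x} = c {s, p} \<Longrightarrow> c {r, x} \<noteq> c {q, r}"
    using no_spider[of x p q r s y] fresh_edge_vertices[OF F] fresh_edge_end[OF F]
    by (clarsimp simp: insert_commute)
  moreover have "c {p, x} = c {p, q} \<Longrightarrow> c {r, x} \<noteq> c {r, s}"
    using no_spider[of x p s r q y] fresh_edge_vertices[OF F] fresh_edge_end[OF F]
    by (clarsimp simp: insert_commute)
  ultimately show ?thesis by blast
qed

text \<open>Towards \<open>p\<close> and \<open>r\<close>, \<open>x\<close> has the colours of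
  \<open>q\<close>; towards \<open>q\<close> and \<open>s\<close>, those of \<open>p\<close>. The
  pattern thus belongs to the cycle edge \<open>pq\<close>.\<close>

definition twin :: "'a \<Rightarrow> 'a \<Rightarrow> 'a \<Rightarrow> 'a \<Rightarrow> 'a \<Rightarrow> bool" where
  "twin p q r s x \<longleftrightarrow> c {p, x} = c {p, q} \<and> c {q, x} = c {p, q} \<and>
     c {r, x} = c {q, r} \<and> c {s, x} = c {s, p}"

text \<open>There are two choices for each pair of opposite corners; the four combinations
  correspond to the four cycle edges.\<close>

lemma fresh_edge_twin:
  assumes F: "fresh_edge p q r s x y"
  shows "twin p q r s x \<or> twin r q p s x \<or> twin p s r q x \<or> twin r s p q x"
  using fresh_edge_corners[OF F] fresh_edge_corners[OF fresh_edge_rotate[OF F]]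
  by (auto simp: twin_def insert_commute)

text \<open>This reduces to one twin pattern by relabelling the cycle. All fresh edges are carried
  over, since two of them are compared later.\<close>

lemma fresh_edge_twin_cases:
  assumes F: "fresh_edge p q r s x y"
  obtains p' q' r' s' where "twin p' q' r' s' x"
    "\<And>u v. fresh_edge p q r s u v \<Longrightarrow> fresh_edge p' q' r' s' u v"
  using fresh_edge_twin[OF F] fresh_edge_rotate fresh_edge_reflect by metis

text \<open>The colour of \<open>qr\<close> on \<open>qy\<close>, or of \<open>sp\<close> on
  \<open>py\<close>, completes a rainbow spider at \<open>x\<close>;
  \<open>fresh_edge_corners\<close> then leaves a single pattern.\<close>

lemma twin_neighbour:
  assumes F: "fresh_edge p q r s x y" and T: "twin p q r s x"
  shows "twin p q r s y"
proof -
  note F' = fresh_edge_commute[OF F]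
  have "c {q, y} \<noteq> c {q, r}"
    using no_spider[of x y q s r p] T fresh_edge_vertices[OF F] fresh_edge_end[OF F]
    by (clarsimp simp: insert_commute twin_def)
  moreover have "c {p, y} \<noteq> c {s, p}"
    using no_spider[of x y p r s q] T fresh_edge_vertices[OF F] fresh_edge_end[OF F]
    by (clarsimp simp: insert_commute twin_def)
  ultimately show ?thesis
    using fresh_edge_corners[OF F'] fresh_edge_corners[OF fresh_edge_rotate[OF F']]
    by (auto simp: twin_def insert_commute)
qed

text \<open>As \<open>z\<close> is a twin too, \<open>zq\<close> has the colour of
  \<open>pq\<close>, and the legs \<open>x, z, q\<close> and \<open>x, s, r\<close> with short leg
  \<open>xy\<close> are rainbow.\<close>

lemma adjacent_fresh_edges_twin:
  assumes F: "fresh_edge p q r s x y" "fresh_edge p q r s x z" and T: "twin p q r s x"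
    and "c {x, y} \<noteq> c {x, z}"
  shows False
proof -
  have "twin p q r s z" using twin_neighbour F(2) T by blast
  then show False
    using no_spider[of x z q s r y] T assms(4)
      fresh_edge_vertices[OF F(1)] fresh_edge_color[OF F(1), of z] fresh_edge_color[OF F(1), of x]
      fresh_edge_vertices[OF F(2)] fresh_edge_color[OF F(2), of z] fresh_edge_color[OF F(2), of x]
    by (auto simp: insert_commute eq_commute[where 'a = nat] twin_def)
qed

text \<open>Three spiders at \<open>x\<close> with long leg \<open>x, z, w\<close> have no cycle
  colour in common, so \<open>xz\<close> repeats the colour of \<open>xy\<close> or
  \<open>zw\<close>. It is then a fresh edge adjacent to both, and \<open>A\<close> equates their
  colours.\<close>

lemma fresh_edges_twin:
  assumes F: "fresh_edge p q r s x y" "fresh_edge p q r s z w" and T: "twin p q r s x"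
    and ne: "c {x, y} \<noteq> c {z, w}"
    and A: "\<And>x y z. fresh_edge p q r s x y \<Longrightarrow> fresh_edge p q r s x z \<Longrightarrow> c {x, y} = c {x, z}"
  shows False
proof -
  have d: "distinct [x, y, z, w]"
    using A[of x y w] A[of x y z] A[of y x z] A[of y x w] F ne
      fresh_edge_commute[OF F(1)] fresh_edge_commute[OF F(2)]
    by (auto simp: insert_commute fresh_edge_def)
  have Ty: "twin p q r s y" using twin_neighbour F(1) T by blast
  have "c {x, z} \<in> {c {x, y}, c {z, w}, c {r, s}, c {s, p}}"
    using no_spider[of x z w s r y]
      d T ne fresh_edge_vertices[OF F(1)] fresh_edge_vertices[OF F(2)]
    by (auto simp: insert_commute twin_def)
  moreover have "c {x, z} \<in> {c {x, y}, c {z, w}, c {q, r}, c {r, s}}"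
    using no_spider[of x z w r s y]
      d T ne fresh_edge_vertices[OF F(1)] fresh_edge_vertices[OF F(2)]
    by (auto simp: insert_commute twin_def)
  moreover have "c {x, z} \<in> {c {x, y}, c {z, w}, c {p, q}, c {s, p}}"
    using no_spider[of x z w y p s] Ty
      d T ne fresh_edge_vertices[OF F(1)] fresh_edge_vertices[OF F(2)]
    by (auto simp: insert_commute twin_def)
  ultimately have "c {x, z} = c {x, y} \<or> c {x, z} = c {z, w}"
    using fresh_edge_vertices(3)[OF F(1)] by auto
  then have "fresh_edge p q r s x z"
    using F d by (auto simp: fresh_edge_def)
  then show False
    using A[of x y z] A[of z x w] fresh_edge_commute[of p q r s x z] F ne by (auto simp: insert_commute)
qed

lemma fresh_edges_same_color:
  assumes F: "fresh_edge p q r s x y" "fresh_edge p q r s z w"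
  shows "c {x, y} = c {z, w}"
proof -
  have adj: "c {x, y} = c {x, z}"
    if "fresh_edge p q r s x y" "fresh_edge p q r s x z" for p q r s x y z
    using that adjacent_fresh_edges_twin by (metis fresh_edge_twin_cases)
  from fresh_edge_twin_cases[OF F(1)] obtain p' q' r' s' where
    "twin p' q' r' s' x" "fresh_edge p' q' r' s' x y" "fresh_edge p' q' r' s' z w"
    using F by metis
  then show ?thesis using fresh_edges_twin adj by blast
qed

section \<open>Counting the colours around a rainbow four-cycle\<close>

lemma rainbow_C4_star_colors:
  assumes C: "rainbow_C4 p q r s" and fin: "finite V"
  shows "card ((\<lambda>x. c {p, x}) ` (V - {p})) \<le> 8"
proof -
  define B where "B = {c {p, q}, c {q, r}, c {r, s}, c {s, p}}"
  define N where "N = (\<lambda>x. c {p, x}) ` (V - {p, q, r, s}) - B"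
  \<comment> \<open>\<open>X\<close> contains one end vertex for each further colour at
    \<open>p\<close>.\<close>
  obtain X where X: "X \<subseteq> V - {p, q, r, s}" "inj_on (\<lambda>x. c {p, x}) X" "N = (\<lambda>x. c {p, x}) ` X"
    using subset_image_inj[of N "\<lambda>x. c {p, x}" "V - {p, q, r, s}"] by (auto simp: N_def)
  have F: "fresh_star p q r s X"
    using C X by (auto simp: fresh_star_def N_def B_def)
  have "card X \<le> 3"
  proof (rule ccontr)
    assume "\<not> card X \<le> 3"
    then obtain Y where "Y \<subseteq> X" "card Y = 4"
      using obtain_subset_with_card_n[of 4 X] by auto
    then obtain l where "set l \<subseteq> X" "distinct l" "length l = 4"
      by (metis card_eq_0_iff distinct_card finite_distinct_list zero_neq_numeral)
    moreover from \<open>length l = 4\<close> obtain x y z w where "l = [x, y, z, w]"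
      by (auto simp: numeral_eq_Suc length_Suc_conv)
    ultimately show False using no_fresh_star[OF F, of x y z w] by simp
  qed
  then have N: "card N \<le> 3" using X by (simp add: card_image)
  \<comment> \<open>The diagonal \<open>pr\<close> is the only edge at \<open>p\<close> not yet
    covered by \<open>B\<close> and \<open>N\<close>.\<close>
  have "(\<lambda>x. c {p, x}) ` (V - {p}) \<subseteq> insert (c {p, r}) B \<union> N"
    by (auto simp: N_def B_def insert_commute)
  then have "card ((\<lambda>x. c {p, x}) ` (V - {p})) \<le> card (insert (c {p, r}) B \<union> N)"
    using fin by (intro card_mono) (auto simp: N_def B_def)
  also have "\<dots> \<le> card (insert (c {p, r}) B) + card N"
    by (rule card_Un_le)
  also have "card (insert (c {p, r}) B) \<le> 5"
    using card_length[of "[c {p, r}, c {p, q}, c {q, r}, c {r, s}, c {s, p}]"] by (simp add: B_def)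
  finally show ?thesis using N by simp
qed

text \<open>The bound is 4 * 8 + 1: eight colours at each corner and at most one fresh
  colour.\<close>

lemma rainbow_C4_colors:
  assumes C: "rainbow_C4 p q r s" and fin: "finite V"
  shows "card (c ` {e. e \<subseteq> V \<and> card e = 2}) \<le> 33"
proof -
  define S where "S u = (\<lambda>x. c {u, x}) ` (V - {u})" for u
  define N where "N = {n \<in> c ` {e. e \<subseteq> V \<and> card e = 2}. fresh_color p q r s n}"
  have finE: "finite (c ` {e. e \<subseteq> V \<and> card e = 2})"
    using fin by simp
  have "n = m" if "n \<in> N" "m \<in> N" for n m
  proof -
    have "\<exists>x y. n = c {x, y} \<and> fresh_edge p q r s x y" if n: "n \<in> N" for n
    proof -
      from n obtain e where e: "e \<subseteq> V" "card e = 2" "n = c e" "fresh_color p q r s n"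
        by (auto simp: N_def)
      from e(2) obtain x y where "e = {x, y}" "x \<noteq> y"
        by (auto simp: card_2_iff)
      with e C show ?thesis by (auto simp: fresh_edge_def)
    qed
    with that fresh_edges_same_color show ?thesis by metis
  qed
  moreover have finN: "finite N" using finE by (simp add: N_def)
  ultimately have N: "card N \<le> 1"
    unfolding One_nat_def card_le_Suc0_iff_eq[OF finN] by blast
  note C2 = rainbow_C4_rotate[OF C]
  note C3 = rainbow_C4_rotate[OF C2]
  note C4 = rainbow_C4_rotate[OF C3]
  have S8: "card (S u) \<le> 8" if "u \<in> {p, q, r, s}" for u
    using that rainbow_C4_star_colors[OF C fin] rainbow_C4_star_colors[OF C2 fin]
      rainbow_C4_star_colors[OF C3 fin] rainbow_C4_star_colors[OF C4 fin]
    unfolding S_def by blast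
  have S: "card (\<Union>u\<in>{p, q, r, s}. S u) \<le> 32"
  proof -
    have "card (\<Union>u\<in>{p, q, r, s}. S u) \<le> (\<Sum>u\<in>{p, q, r, s}. card (S u))"
      by (rule card_UN_le) simp
    also have "\<dots> \<le> of_nat (card {p, q, r, s}) * 8"
      by (rule sum_bounded_above) (rule S8)
    also have "card {p, q, r, s} \<le> 4"
      using card_length[of "[p, q, r, s]"] by simp
    finally show ?thesis by simp
  qed
  have "c ` {e. e \<subseteq> V \<and> card e = 2} \<subseteq> (\<Union>u\<in>{p, q, r, s}. S u) \<union> N"
  proof
    fix n assume n: "n \<in> c ` {e. e \<subseteq> V \<and> card e = 2}"
    show "n \<in> (\<Union>u\<in>{p, q, r, s}. S u) \<union> N"
    proof (cases "fresh_color p q r s n")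
      case True
      then show ?thesis using n by (simp add: N_def)
    next
      case False
      then obtain u x where "u \<in> {p, q, r, s}" "x \<in> V" "x \<noteq> u" "c {u, x} = n"
        unfolding fresh_color_def by blast
      then have "n \<in> S u" by (auto simp: S_def)
      with \<open>u \<in> {p, q, r, s}\<close> show ?thesis by blast
    qed
  qed
  then have "card (c ` {e. e \<subseteq> V \<and> card e = 2}) \<le> card ((\<Union>u\<in>{p, q, r, s}. S u) \<union> N)"
    using fin finN by (intro card_mono) (simp_all add: S_def)
  also have "\<dots> \<le> card (\<Union>u\<in>{p, q, r, s}. S u) + card N"
    by (rule card_Un_le)
  finally show ?thesis using S N by simp
qed

section \<open>Rainbow five-vertex paths and long rainbow cycles\<close>

definition rainbow_P5 :: "'a \<Rightarrow> 'a \<Rightarrow> 'a \<Rightarrow> 'a \<Rightarrow> 'a \<Rightarrow> bool" where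
  "rainbow_P5 p q r s u \<longleftrightarrow> {p, q, r, s, u} \<subseteq> V \<and> distinct [p, q, r, s, u] \<and>
     distinct [c {p, q}, c {q, r}, c {r, s}, c {s, u}]"

text \<open>A five-vertex path with a pendant edge at its middle vertex is the spider
  itself.\<close>

lemma rainbow_P5_pendant:
  assumes "rainbow_P5 p q r s u" "x \<in> V" "x \<notin> {p, q, r, s, u}"
  shows "c {r, x} \<in> {c {p, q}, c {q, r}, c {r, s}, c {s, u}}"
  using no_spider[of r q p s u x] assms by (auto simp: rainbow_P5_def insert_commute)

lemma rainbow_P5_edge:
  assumes "rainbow_P5 p q r s u" "{x, y} \<subseteq> V - {p, q, r, s, u}" "x \<noteq> y"
    "c {x, y} \<notin> {c {p, q}, c {q, r}, c {r, s}, c {s, u}}"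
  shows "{p, q, r, s, u, x, y} \<subseteq> V" "distinct [p, q, r, s, u, x, y]"
    "distinct [c {p, q}, c {q, r}, c {r, s}, c {s, u}, c {x, y}]"
proof -
  show "{p, q, r, s, u, x, y} \<subseteq> V"
    using assms(1,2) unfolding rainbow_P5_def by blast
  show "distinct [p, q, r, s, u, x, y]"
    using assms(1-3) unfolding rainbow_P5_def by simp metis
  show "distinct [c {p, q}, c {q, r}, c {r, s}, c {s, u}, c {x, y}]"
    using assms(1,4) unfolding rainbow_P5_def by simp metis
qed

text \<open>If \<open>rx\<close> had the colour of \<open>pq\<close>, the leg \<open>r, x, y\<close>
  could replace \<open>r, q, p\<close>, with \<open>rq\<close> as short leg; symmetrically for
  \<open>su\<close>.\<close>

lemma rainbow_P5_pendant_edge: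
  assumes P: "rainbow_P5 p q r s u" and xy: "{x, y} \<subseteq> V - {p, q, r, s, u}" "x \<noteq> y"
    and new: "c {x, y} \<notin> {c {p, q}, c {q, r}, c {r, s}, c {s, u}}"
  shows "c {r, x} \<in> {c {q, r}, c {r, s}}"
proof -
  note P' = rainbow_P5_edge[OF P xy new]
  have "c {r, x} \<in> {c {p, q}, c {q, r}, c {r, s}, c {s, u}}"
    using rainbow_P5_pendant[OF P] xy by blast
  moreover have "c {r, x} \<noteq> c {p, q}"
    using no_spider[of r x y s u q] P' by (clarsimp simp: insert_commute)
  moreover have "c {r, x} \<noteq> c {s, u}"
    using no_spider[of r x y q p s] P' by (clarsimp simp: insert_commute)
  ultimately show ?thesis by blast
qed

text \<open>The other three colour pairs give rainbow spiders at \<open>x\<close> with short leg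
  \<open>xy\<close>. In the surviving pair both long legs would have to end in
  \<open>r\<close>.\<close>

lemma rainbow_P5_apex:
  assumes P: "rainbow_P5 p q r s u" and xy: "{x, y} \<subseteq> V - {p, q, r, s, u}" "x \<noteq> y"
    and new: "c {x, y} \<notin> {c {p, q}, c {q, r}, c {r, s}, c {s, u}}"
    and q: "c {q, x} \<in> {c {p, q}, c {q, r}}" and s: "c {s, x} \<in> {c {r, s}, c {s, u}}"
  shows "c {q, x} = c {p, q} \<and> c {s, x} = c {s, u}"
proof -
  note P' = rainbow_P5_edge[OF P xy new]
  have "c {q, x} = c {q, r} \<Longrightarrow> c {s, x} \<noteq> c {r, s}"
    using no_spider[of x q p s u y] P' by (clarsimp simp: insert_commute)
  moreover have "c {q, x} = c {q, r} \<Longrightarrow> c {s, x} \<noteq> c {s, u}"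
    using no_spider[of x q p s r y] P' by (clarsimp simp: insert_commute)
  moreover have "c {q, x} = c {p, q} \<Longrightarrow> c {s, x} \<noteq> c {r, s}"
    using no_spider[of x q r s u y] P' by (clarsimp simp: insert_commute)
  ultimately show ?thesis using q s by blast
qed

text \<open>The cycle is a \<open>k\<close>-periodic sequence, so that shifted indices need no
  reduction.\<close>

definition rainbow_cycle :: "nat \<Rightarrow> (nat \<Rightarrow> 'a) \<Rightarrow> bool" where
  "rainbow_cycle k v \<longleftrightarrow> range v \<subseteq> V \<and> (\<forall>i j. v i = v j \<longleftrightarrow> i mod k = j mod k) \<and>
     (\<forall>i j. c {v i, v (i + 1)} = c {v j, v (j + 1)} \<longleftrightarrow> i mod k = j mod k)"

lemma rainbow_cycle_P5:
  assumes "rainbow_cycle k v" "k \<ge> 5"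
  shows "rainbow_P5 (v i) (v (i + 1)) (v (i + 2)) (v (i + 3)) (v (i + 4))"
proof -
  have V: "v j \<in> V" for j
    using assms(1) by (auto simp: rainbow_cycle_def)
  have v: "v (i + a) = v (i + b) \<longleftrightarrow> a = b"
    and e: "c {v (i + a), v (i + a + 1)} = c {v (i + b), v (i + b + 1)} \<longleftrightarrow> a = b"
    if "a < 5" "b < 5" for a b
    using assms that add_mod_cancel[of a k b i] by (auto simp: rainbow_cycle_def)
  show ?thesis
    using v[of 0 1] v[of 0 2] v[of 0 3] v[of 0 4] v[of 1 2] v[of 1 3] v[of 1 4] v[of 2 3] v[of 2 4] v[of 3 4]
      e[of 0 1] e[of 0 2] e[of 0 3] e[of 1 2] e[of 1 3] e[of 2 3] V
    by (auto simp: rainbow_P5_def numeral_eq_Suc)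
qed

text \<open>\<open>Pow (range v)\<close> also contains sets that are not edges; as a finite superset
  it suffices for an upper bound.\<close>

lemma long_rainbow_cycle_color:
  assumes v: "rainbow_cycle k v" and k: "k \<ge> 5" and xy: "{x, y} \<subseteq> V" "x \<noteq> y"
  shows "c {x, y} \<in> c ` Pow (range v)"
proof (rule ccontr)
  assume new: "c {x, y} \<notin> c ` Pow (range v)"
  note P = rainbow_cycle_P5[OF v k]
  \<comment> \<open>The middle vertex of \<open>P i\<close> is \<open>v (i + 2)\<close>, so \<open>v j\<close> is reached through the index \<open>j + k\<close>.\<close>
  have out: "x \<notin> range v \<Longrightarrow> y \<notin> range v" if "{x, y} \<subseteq> V" "c {x, y} \<notin> c ` Pow (range v)" for x y
  proof
    assume x: "x \<notin> range v" and "y \<in> range v"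
    then obtain j where "y = v j" by blast
    moreover have "j + k - 2 + 2 = j + k" using k by simp
    ultimately have "y = v (j + k - 2 + 2)"
      using v by (simp only: rainbow_cycle_def mod_add_self2)
    then have "c {y, x} \<in> c ` Pow (range v)"
      using rainbow_P5_pendant[OF P[of "j + k - 2"], of x] that x by auto
    with that show False by (simp add: insert_commute)
  qed
  have "x \<notin> range v \<or> y \<notin> range v" using new by blast
  moreover have "y \<notin> range v \<Longrightarrow> x \<notin> range v"
    using out[of y x] xy(1) new by (metis insert_commute)
  ultimately have xy': "x \<notin> range v" "y \<notin> range v"
    using out[OF xy(1) new] by metis+
  have new': "c {x, y} \<noteq> c {v i, v j}" for i j
    using new by blast
  have out': "{x, y} \<subseteq> V - {v i, v j, v m, v n, v l}" for i j m n l
    using xy(1) xy' by blast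
  have new'': "c {x, y} \<notin> {c {v i, v j}, c {v j, v m}, c {v m, v n}, c {v n, v l}}" for i j m n l
    using new' by blast
  have e: "c {v (i + 2), x} \<in> {c {v (i + 1), v (i + 2)}, c {v (i + 2), v (i + 3)}}" for i
    using rainbow_P5_pendant_edge[OF P out' xy(2) new''] .
  \<comment> \<open>The path used has middle vertex \<open>v (i + 3)\<close>, with neighbours
    \<open>v (i + 2)\<close> and \<open>v (i + 4)\<close>.\<close>
  have "c {v (i + 2), x} = c {v (i + 1), v (i + 2)} \<and> c {v (i + 4), x} = c {v (i + 4), v (i + 5)}" for i
  proof (rule rainbow_P5_apex[OF _ out' xy(2) new'' e])
    show "rainbow_P5 (v (i + 1)) (v (i + 2)) (v (i + 3)) (v (i + 4)) (v (i + 5))"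
      using P[of "i + 1"] by (simp add: numeral_eq_Suc)
    show "c {v (i + 4), x} \<in> {c {v (i + 3), v (i + 4)}, c {v (i + 4), v (i + 5)}}"
      using e[of "i + 2"] by (simp add: numeral_eq_Suc)
  qed
  \<comment> \<open>\<open>v 4\<close> is the right neighbour of the middle for \<open>i = 0\<close>
    and the left one for \<open>i = 2\<close>.\<close>
  from this[of 0] this[of 2] have "c {v 3, v 4} = c {v 4, v 5}"
    by (simp add: numeral_eq_Suc)
  then show False
    using P[of 3] by (simp add: rainbow_P5_def)
qed

lemma long_rainbow_cycle_colors:
  assumes v: "rainbow_cycle k v" and k: "k \<ge> 5"
  shows "card (c ` {e. e \<subseteq> V \<and> card e = 2}) \<le> 2 ^ k"
proof -
  have "v i \<in> v ` {..<k}" for i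
    using v k by (intro image_eqI[of _ _ "i mod k"]) (auto simp: rainbow_cycle_def)
  then have W: "range v = v ` {..<k}" by auto
  have "c ` {e. e \<subseteq> V \<and> card e = 2} \<subseteq> c ` Pow (range v)"
    using long_rainbow_cycle_color[OF v k] by (auto simp: card_2_iff)
  then have "card (c ` {e. e \<subseteq> V \<and> card e = 2}) \<le> card (c ` Pow (range v))"
    by (intro card_mono) (simp_all add: W)
  also have "\<dots> \<le> card (Pow (range v))"
    by (intro card_image_le) (simp add: W)
  also have "\<dots> \<le> 2 ^ k"
    using card_image_le[of "{..<k}" v] by (simp add: W card_Pow)
  finally show ?thesis .
qed

text \<open>The sum covers the bound 33 for \<open>k = 4\<close> and the bound \<open>2 ^ k\<close>
  for longer cycles.\<close>

lemma rainbow_cycle_colors: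
  assumes v: "rainbow_cycle k v" and k: "k \<ge> 4" and fin: "finite V"
  shows "card (c ` {e. e \<subseteq> V \<and> card e = 2}) \<le> 33 + 2 ^ k"
proof (cases "k = 4")
  case True
  have "rainbow_C4 (v 0) (v 1) (v 2) (v 3)"
  proof -
    have "v 4 = v 0" "range v \<subseteq> V" using v True by (auto simp: rainbow_cycle_def)
    moreover have "v i = v j \<longleftrightarrow> i = j"
        "c {v i, v (i + 1)} = c {v j, v (j + 1)} \<longleftrightarrow> i = j" if "i < 4" "j < 4" for i j
      using v True that by (auto simp: rainbow_cycle_def)
    from this(1)[of 0 1] this(1)[of 0 2] this(1)[of 0 3] this(1)[of 1 2] this(1)[of 1 3] this(1)[of 2 3]
      this(2)[of 0 1] this(2)[of 0 2] this(2)[of 0 3] this(2)[of 1 2] this(2)[of 1 3] this(2)[of 2 3]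
    have "distinct [v 0, v 1, v 2, v 3]"
      "distinct [c {v 0, v 1}, c {v 1, v 2}, c {v 2, v 3}, c {v 3, v 4}]"
      by (simp_all add: numeral_eq_Suc)
    ultimately show ?thesis by (auto simp: rainbow_C4_def)
  qed
  from rainbow_C4_colors[OF this fin] show ?thesis by simp
next
  case False
  then show ?thesis using long_rainbow_cycle_colors[OF v] k by simp
qed

end

section \<open>From subgraphs to the spider and cycle conditions\<close>

lemma verts_spider:
  "verts (spider 2 2 1) = {(0, 0), (0, 1), (0, 2), (1, 1), (1, 2), (2, 1)}"
proof -
  have "verts (spider 2 2 1) = (\<Union>i\<in>{..<3}. leg_vertex i ` {..[2, 2, 1] ! i})"
    unfolding spider_def by auto
  also have "\<dots> = {(0, 0), (0, 1), (0, 2), (1, 1), (1, 2), (2, 1)}"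
    by (simp add: leg_vertex_def numeral_eq_Suc lessThan_Suc atMost_Suc insert_commute)
  finally show ?thesis .
qed

lemma edges_spider:
  "edges (spider 2 2 1) =
    {{(0, 0), (0, 1)}, {(0, 1), (0, 2)}, {(0, 0), (1, 1)}, {(1, 1), (1, 2)}, {(0, 0), (2, 1)}}"
proof -
  have "edges (spider 2 2 1) =
      (\<Union>i\<in>{..<3}. (\<lambda>j. {leg_vertex i j, leg_vertex i (j + 1)}) ` {..<[2, 2, 1] ! i})"
    unfolding spider_def by auto
  also have "\<dots> = {{(0, 0), (0, 1)}, {(0, 1), (0, 2)}, {(0, 0), (1, 1)}, {(1, 1), (1, 2)}, {(0, 0), (2, 1)}}"
    by (simp add: leg_vertex_def numeral_eq_Suc lessThan_Suc insert_commute)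
  finally show ?thesis .
qed

lemma spider_free_if_rainbow_free:
  assumes K: "complete_graph K" and free: "rainbow_free (spider 2 2 1) K c"
  shows "spider_free (verts K) c"
proof
  fix v a a' b b' p
  show "\<not> (distinct [v, a, a', b, b', p] \<and> {v, a, a', b, b', p} \<subseteq> verts K \<and>
      distinct [c {v, a}, c {a, a'}, c {v, b}, c {b, b'}, c {v, p}])"
  proof
    assume *: "distinct [v, a, a', b, b', p] \<and> {v, a, a', b, b', p} \<subseteq> verts K \<and>
      distinct [c {v, a}, c {a, a'}, c {v, b}, c {b, b'}, c {v, p}]"
    define F where "F = \<lparr>verts = {v, a, a', b, b', p}, edges = {{v, a}, {a, a'}, {v, b}, {b, b'}, {v, p}}\<rparr>"
    \<comment> \<open>The default value \<open>(0, 0)\<close> is the image of the branch vertex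
      \<open>v\<close>.\<close>
    define f where "f = (\<lambda>_. (0, 0))(a := (0, 1), a' := (0, 2), b := (1, 1), b' := (1, 2), p := (2 :: nat, 1 :: nat))"
    have f: "f v = (0, 0)" "f a = (0, 1)" "f a' = (0, 2)" "f b = (1, 1)" "f b' = (1, 2)" "f p = (2, 1)"
      using * by (simp_all add: f_def)
    have "\<forall>e\<in>edges F. e \<subseteq> verts F \<and> card e = 2"
      using * by (clarsimp simp: F_def)
    moreover have "finite (verts F)" "verts F \<subseteq> verts K"
      using * by (simp_all add: F_def)
    ultimately have "subgraph_of F K"
      using K by (auto simp: subgraph_of_def simple_graph_def complete_graph_def)
    moreover have "graph_isomorphic F (spider 2 2 1)"
      unfolding graph_isomorphic_def bij_betw_def verts_spider edges_spider
      by (intro exI[of _ f] conjI) (simp_all add: F_def inj_on_def f)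
    moreover have "distinct (map c [{v, a}, {a, a'}, {v, b}, {b, b'}, {v, p}])"
      using * by simp
    then have "inj_on c (set [{v, a}, {a, a'}, {v, b}, {b, b'}, {v, p}])"
      unfolding distinct_map by blast
    then have "rainbow c F"
      unfolding rainbow_def F_def by (simp only: list.set graph.simps)
    ultimately show False using free unfolding rainbow_free_def by blast
  qed
qed

lemma (in spider_free) rainbow_cycle_if_not_rainbow_free:
  assumes K: "verts K = V" and nfree: "\<not> rainbow_free (cycle_graph k) K c"
    and k: "k \<ge> 3"
  obtains v where "rainbow_cycle k v"
proof -
  from nfree obtain F f where F: "subgraph_of F K" "rainbow c F"
    and f: "bij_betw f (verts F) {..<k}"
      "{{i, (i + 1) mod k} | i. i < k} = (\<lambda>e. f ` e) ` edges F"
    by (auto simp: rainbow_free_def graph_isomorphic_def cycle_graph_def)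
  define g where "g = inv_into (verts F) f"
  define v where "v i = g (i mod k)" for i
  have g: "bij_betw g {..<k} (verts F)"
    using f(1) by (simp add: g_def bij_betw_inv_into)
  have v: "v i = v j \<longleftrightarrow> i mod k = j mod k" for i j
    using g k by (auto simp: v_def bij_betw_def inj_on_eq_iff)
  have "range v \<subseteq> V"
    using g k F(1) K by (auto simp: v_def bij_betw_def subgraph_of_def)
  moreover have edge: "{v i, v (i + 1)} \<in> edges F" for i
  proof -
    have "{i mod k, (i mod k + 1) mod k} \<in> (\<lambda>e. f ` e) ` edges F"
      unfolding f(2)[symmetric] using k by auto
    then obtain e where e: "e \<in> edges F" "f ` e = {i mod k, (i + 1) mod k}"
      by (auto simp: mod_simps)
    have "e \<subseteq> verts F" using F(1) e(1) by (auto simp: subgraph_of_def simple_graph_def)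
    then have "e = g ` f ` e"
      unfolding g_def using f(1) by (simp add: bij_betw_def)
    then show ?thesis using e by (simp add: v_def)
  qed
  moreover have "c {v i, v (i + 1)} = c {v j, v (j + 1)} \<longleftrightarrow> i mod k = j mod k" for i j
  proof
    assume "c {v i, v (i + 1)} = c {v j, v (j + 1)}"
    then have "{v i, v (i + 1)} = {v j, v (j + 1)}"
      using F(2) edge by (auto simp: rainbow_def inj_on_def)
    \<comment> \<open>Matching the two edges crosswise would make \<open>j + 2\<close> and
      \<open>j\<close> congruent modulo \<open>k\<close>, impossible for
      \<open>k \<ge> 3\<close>.\<close>
    moreover have "\<not> (v i = v (j + 1) \<and> v (i + 1) = v j)"
    proof
      assume "v i = v (j + 1) \<and> v (i + 1) = v j"
      then have "i mod k = (j + 1) mod k" "(i + 1) mod k = j mod k" by (simp_all add: v)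
      then have "(j + 2) mod k = (j + 0) mod k" by (metis add.assoc mod_add_left_eq one_add_one add_0_right)
      then show False using add_mod_cancel[of 2 k 0 j] k by simp
    qed
    ultimately have "v i = v j" by (auto simp: doubleton_eq_iff)
    then show "i mod k = j mod k" by (simp add: v)
  next
    assume "i mod k = j mod k"
    then have "(i + 1) mod k = (j + 1) mod k" by (metis mod_add_left_eq)
    with \<open>i mod k = j mod k\<close> show "c {v i, v (i + 1)} = c {v j, v (j + 1)}" by (simp add: v_def)
  qed
  ultimately have "rainbow_cycle k v"
    using v unfolding rainbow_cycle_def by blast
  then show ?thesis by (rule that)
qed

theorem theorem11:
  fixes k :: nat
  assumes "k \<ge> 4"
  shows "rainbow_le (spider 2 2 1) (cycle_graph k)"
  unfolding rainbow_le_def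
\<comment> \<open>The threshold exceeds the bound of \<open>rainbow_cycle_colors\<close> by
  one.\<close>
proof (intro exI[of _ "34 + 2 ^ k"] conjI allI impI)
  fix K :: "nat graph" and c
  assume K: "complete_graph K" and col: "colored_in_at_least (34 + 2 ^ k) K c"
    and free: "rainbow_free (spider 2 2 1) K c"
  interpret spider_free "verts K" c
    using K free by (rule spider_free_if_rainbow_free)
  show "rainbow_free (cycle_graph k) K c"
  proof (rule ccontr)
    assume "\<not> rainbow_free (cycle_graph k) K c"
    then obtain v where "rainbow_cycle k v"
      using rainbow_cycle_if_not_rainbow_free[OF refl, of k] assms by auto
    then have "card (c ` edges K) \<le> 33 + 2 ^ k"
      using rainbow_cycle_colors[of k v] assms K by (simp add: complete_graph_def simple_graph_def)
    with col show False by (simp add: colored_in_at_least_def)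
  qed
qed simp

end
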